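(* For every graph $\mathbf{G}$ with $n$ vertices, if $\mathbf{G}\le_4\mathbf{K}_3$, then $\mathbf{G}\to\mathbf{K}_{3\lceil\sqrt{n}\rceil}$.
   Context: Graphs are structures with a single symmetric binary edge relation; $\mathbf{K}_m$ is the complete loopless graph on $m$ vertices, and $\mathbf{G}\to\mathbf{K}_m$ means $\mathbf{G}$ has a proper $m$-coloring (a homomorphism to $\mathbf{K}_m$). A partial homomorphism from $\mathbf{G}$ to $\mathbf{K}_3$ is a proper 3-coloring of an induced subgraph $\mathbf{G}|_X$. A $k$-strategy on $\mathbf{G}$ and $\mathbf{K}_3$ is a nonempty collection $\mathscr{H}$ of partial homomorphisms closed under restrictions such that for every $h\in\mathscr{H}$ with $|\mathrm{dom}(h)|<k$ and every vertex $x\notin\mathrm{dom}(h)$ some $f\in\mathscr{H}$ extends $h$ with $\mathrm{dom}(f)=\mathrm{dom}(h)\cup\{x\}$; $\mathbf{G}\le_k\mathbf{K}_3$ means such a strategy exists. *)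

theory Defs
  imports Complex_Main "Graph_Theory.Pair_Digraph"
begin

text \<open>
  A graph is a structure with one symmetric binary relation, possibly with loops: a
  \<^locale>\<open>pair_pseudo_graph\<close> in the library (which also requires finitely many vertices).
\<close>

definition graph_hom :: "'a pair_pre_digraph \<Rightarrow> 'b pair_pre_digraph \<Rightarrow> ('a \<Rightarrow> 'b) \<Rightarrow> bool" where
  "graph_hom G H f \<longleftrightarrow>
     (\<forall>x \<in> pverts G. f x \<in> pverts H) \<and> (\<forall>(x, y) \<in> parcs G. (f x, f y) \<in> parcs H)"

definition maps_to :: "'a pair_pre_digraph \<Rightarrow> 'b pair_pre_digraph \<Rightarrow> bool" where
  "maps_to G H \<longleftrightarrow> (\<exists>f. graph_hom G H f)"

definition complete_graph :: "nat \<Rightarrow> nat pair_pre_digraph" where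
  "complete_graph m = \<lparr> pverts = {..<m}, parcs = {(i, j). i < m \<and> j < m \<and> i \<noteq> j} \<rparr>"

definition induced :: "'a pair_pre_digraph \<Rightarrow> 'a set \<Rightarrow> 'a pair_pre_digraph" where
  "induced G X = \<lparr> pverts = X, parcs = parcs G \<inter> X \<times> X \<rparr>"

definition partial_hom :: "'a pair_pre_digraph \<Rightarrow> 'b pair_pre_digraph \<Rightarrow> ('a \<rightharpoonup> 'b) \<Rightarrow> bool" where
  "partial_hom G H h \<longleftrightarrow>
     dom h \<subseteq> pverts G \<and> graph_hom (induced G (dom h)) H (\<lambda>x. the (h x))"

definition k_strategy ::
  "nat \<Rightarrow> 'a pair_pre_digraph \<Rightarrow> 'b pair_pre_digraph \<Rightarrow> ('a \<rightharpoonup> 'b) set \<Rightarrow> bool" where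
  "k_strategy k G H S \<longleftrightarrow>
     S \<noteq> {} \<and>
     (\<forall>h \<in> S. partial_hom G H h) \<and>
     (\<forall>h \<in> S. \<forall>X. h |` X \<in> S) \<and>
     (\<forall>h \<in> S. card (dom h) < k \<longrightarrow>
        (\<forall>x \<in> pverts G - dom h. \<exists>f \<in> S. h \<subseteq>\<^sub>m f \<and> dom f = insert x (dom h)))"

definition k_consistent ::
  "nat \<Rightarrow> 'a pair_pre_digraph \<Rightarrow> 'b pair_pre_digraph \<Rightarrow> bool" where
  "k_consistent k G H \<longleftrightarrow> (\<exists>S. k_strategy k G H S)"

end

theory Submission
  imports Defs
begin

text \<open>
  Colouring with few colours as in Wigderson's algorithm. As long as some vertex has at least
  $s = \lceil\sqrt n\rceil$ uncoloured neighbours, colour these with two fresh colours; this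
  happens at most $s$ times. The remaining graph has maximum degree below $s$ and is coloured
  greedily with $s$ further colours. Neighbourhoods are bipartite because of the strategy: when
  the colours of a vertex $x$ and of one neighbour $r$ are fixed, the colour of every vertex that
  is joined to $r$ inside the neighbourhood of $x$ is forced, and checking this along an edge
  involves only four vertices at a time.
\<close>

definition proper_on :: "('a \<times> 'a) set \<Rightarrow> 'a set \<Rightarrow> ('a \<Rightarrow> 'c) \<Rightarrow> bool" where
  "proper_on E W f \<longleftrightarrow> (\<forall>u \<in> W. \<forall>v \<in> W. (u, v) \<in> E \<longrightarrow> f u \<noteq> f v)"

lemma greedy_colouring:
  fixes E :: "('a \<times> 'a) set"
  assumes "sym E" "irrefl E" "finite W"
    and "\<And>v. v \<in> W \<Longrightarrow> card (W \<inter> E `` {v}) < s"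
  shows "\<exists>f :: 'a \<Rightarrow> nat. f ` W \<subseteq> {..<s} \<and> proper_on E W f"
  using assms(3,4)
proof (induction W rule: finite_induct)
  case empty
  then show ?case by (simp add: proper_on_def)
next
  case (insert w W)
  have "card (W \<inter> E `` {v}) < s" if "v \<in> W" for v
    using insert.prems[of v] that insert.hyps(1)
      card_mono[of "insert w W \<inter> E `` {v}" "W \<inter> E `` {v}"] by fastforce
  then obtain f :: "'a \<Rightarrow> nat" where f: "f ` W \<subseteq> {..<s}" "proper_on E W f"
    using insert.IH by blast
  let ?N = "insert w W \<inter> E `` {w}"
  have "card (f ` ?N) < s"
    using insert.prems[of w] card_image_le[of ?N f] insert.hyps(1) by fastforce
  then have "\<not> {..<s} \<subseteq> f ` ?N"
    using card_mono[of "f ` ?N" "{..<s}"] insert.hyps(1) by fastforce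
  then obtain c where c: "c < s" "c \<notin> f ` ?N"
    by blast
  have "proper_on E (insert w W) (f(w := c))"
    using f(2) c(2) assms(1,2) insert.hyps(2)
    by (auto simp: proper_on_def irrefl_def dest: symD)
  moreover have "(f(w := c)) ` insert w W \<subseteq> {..<s}"
    using f(1) c(1) by auto
  ultimately show ?case by blast
qed

text \<open>The number \<open>m\<close> bounds the rounds still to come: each round uses up at least
  \<open>s\<close> vertices of \<open>W\<close>, so \<open>W\<close> is empty when \<open>m\<close>
  reaches 0. Bipartiteness is asked of the neighbourhoods in all of \<open>E\<close>, not only
  within \<open>W\<close>, so that it passes to smaller sets \<open>W\<close> unchanged.\<close>

lemma wigderson_colouring:
  fixes E :: "('a \<times> 'a) set"
  assumes "sym E" "irrefl E" "0 < s" "finite W" "card W \<le> m * s"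
    and "\<And>v. v \<in> W \<Longrightarrow> \<exists>b :: 'a \<Rightarrow> bool. proper_on E (E `` {v}) b"
  shows "\<exists>f :: 'a \<Rightarrow> nat. f ` W \<subseteq> {..<2 * m + s} \<and> proper_on E W f"
  using assms(4-6)
proof (induction m arbitrary: W)
  case 0
  then show ?case by (simp add: proper_on_def)
next
  case (Suc m)
  show ?case
  proof (cases "\<exists>v\<in>W. s \<le> card (W \<inter> E `` {v})")
    case True
    then obtain v where v: "v \<in> W" "s \<le> card (W \<inter> E `` {v})" by blast
    let ?R = "W - E `` {v}"
    have "card W = card ?R + card (W \<inter> E `` {v})"
      using card_Int_Diff[OF Suc.prems(1), of "E `` {v}"] by linarith
    then have "card ?R \<le> m * s"
      using v(2) Suc.prems(2) by simp
    then obtain f :: "'a \<Rightarrow> nat" where f: "f ` ?R \<subseteq> {..<2 * m + s}" "proper_on E ?R f"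
      using Suc.IH[of ?R] Suc.prems(1,3) by blast
    obtain b :: "'a \<Rightarrow> bool" where b: "proper_on E (E `` {v}) b"
      using Suc.prems(3)[OF v(1)] by blast
    \<comment> \<open>The induction hypothesis uses only colours below \<open>2 * m + s\<close>, so
      the next two are fresh for the neighbourhood of \<open>v\<close>. The vertex \<open>v\<close>
      itself stays in \<open>?R\<close>, as there are no loops.\<close>
    define g where "g u = (if u \<in> E `` {v} then 2 * m + s + of_bool (b u) else f u)" for u
    have lt: "f u < 2 * m + s" if "u \<in> ?R" for u
      using f(1) that by blast
    have "g u < 2 * Suc m + s" if "u \<in> W" for u
    proof (cases "u \<in> E `` {v}")
      case True
      then show ?thesis by (cases "b u") (simp_all add: g_def)
    next
      case False
      then show ?thesis using lt[of u] that by (simp add: g_def)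
    qed
    then have "g ` W \<subseteq> {..<2 * Suc m + s}"
      by blast
    moreover have "proper_on E W g"
      unfolding proper_on_def
    proof (intro ballI impI)
      fix x y assume xy: "x \<in> W" "y \<in> W" "(x, y) \<in> E"
      show "g x \<noteq> g y"
      proof (cases "x \<in> E `` {v} \<longleftrightarrow> y \<in> E `` {v}")
        case True
        then show ?thesis
          using xy b f(2) by (cases "y \<in> E `` {v}") (simp_all add: g_def proper_on_def)
      next
        case False
        then show ?thesis
          using xy lt[of x] lt[of y] by (cases "y \<in> E `` {v}") (simp_all add: g_def)
      qed
    qed
    ultimately show ?thesis by blast
  next
    case False
    then have "card (W \<inter> E `` {v}) < s" if "v \<in> W" for v
      using that by (simp add: not_le)
    then obtain f :: "'a \<Rightarrow> nat" where f: "f ` W \<subseteq> {..<s}" "proper_on E W f"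
      using greedy_colouring[OF assms(1,2) Suc.prems(1)] by blast
    have "f ` W \<subseteq> {..<2 * Suc m + s}"
      using f(1) by (rule order_trans) simp
    then show ?thesis using f(2) by auto
  qed
qed

lemma k_strategy_extend:
  assumes "k_strategy k G H S" "h \<in> S" "card (dom h) < k" "x \<in> pverts G"
  obtains f where "f \<in> S" "h \<subseteq>\<^sub>m f" "dom f = insert x (dom h)"
proof (cases "x \<in> dom h")
  case True
  then show ?thesis using that[of h] assms(2) by (simp add: insert_absorb)
next
  case False
  then show ?thesis using that assms unfolding k_strategy_def by blast
qed

lemma k_strategy_restrict:
  assumes "k_strategy k G H S" "h \<in> S"
  shows "h |` X \<in> S"
  using assms unfolding k_strategy_def by blast

lemma k_strategy_edge:
  assumes "k_strategy k G H S" "h \<in> S" "(u, v) \<in> parcs G" "h u = Some i" "h v = Some j"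
  shows "(i, j) \<in> parcs H"
proof -
  have "partial_hom G H h"
    using assms(1,2) unfolding k_strategy_def by blast
  moreover have "(u, v) \<in> parcs (induced G (dom h))"
    using assms(3-5) by (auto simp: induced_def)
  ultimately have "(the (h u), the (h v)) \<in> parcs H"
    unfolding partial_hom_def graph_hom_def by blast
  then show ?thesis
    using assms(4,5) by simp
qed

lemma k_strategy_singleton:
  assumes "k_strategy k G H S" "0 < k" "x \<in> pverts G"
  obtains c where "[x \<mapsto> c] \<in> S"
proof -
  obtain h where "h \<in> S"
    using assms(1) unfolding k_strategy_def by blast
  then have "Map.empty \<in> S"
    using k_strategy_restrict[OF assms(1), of h "{}"] by (simp add: restrict_map_def)
  then obtain f where "f \<in> S" "dom f = {x}"
    using k_strategy_extend[OF assms(1), of Map.empty x] assms(2,3) by auto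
  then show ?thesis
    using that by (auto simp: dom_eq_singleton_conv)
qed

text \<open>Loops are not excluded beforehand, but colouring needs a loop-free graph: the strategy
  colours every single vertex, and a loop there would give a loop of \<open>H\<close>.\<close>

lemma k_strategy_irrefl:
  assumes "pair_pseudo_graph G" "k_strategy k G H S" "0 < k" "irrefl (parcs H)"
  shows "irrefl (parcs G)"
proof (rule irreflI)
  interpret pair_pseudo_graph G by fact
  fix x
  show "(x, x) \<notin> parcs G"
  proof
    assume e: "(x, x) \<in> parcs G"
    then have "x \<in> pverts G" using in_arcsD1 by blast
    then obtain c where "[x \<mapsto> c] \<in> S"
      using k_strategy_singleton[OF assms(2,3)] by blast
    then show False
      using k_strategy_edge[OF assms(2) _ e] assms(4) by (fastforce simp: irrefl_def)
  qed
qed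

text \<open>Once \<open>x\<close> has colour \<open>c\<close>, two colours remain for its
  neighbours. In each component of the neighbourhood one root is coloured, and the colours forced by
  it do not depend on the path taken, so they form a proper 2-colouring.\<close>

lemma neighbourhood_bipartite:
  fixes G :: "'a pair_pre_digraph"
  assumes G: "pair_pseudo_graph G"
    and S: "k_strategy 4 G (complete_graph 3) S"
    and x: "x \<in> pverts G"
  shows "\<exists>b :: 'a \<Rightarrow> bool. proper_on (parcs G) (parcs G `` {x}) b"
proof -
  interpret pair_pseudo_graph G by fact
  let ?E = "parcs G"
  define N where "N = ?E `` {x}"
  \<comment> \<open>The edges inside the neighbourhood; \<open>R\<^sup>*\<close> means lying in the
    same component.\<close>
  define R where "R = ?E \<inter> N \<times> N"
  have symE: "(v, u) \<in> ?E" if "(u, v) \<in> ?E" for u v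
    using sym_arcs that by (simp add: symmetric_def symD)
  have N: "(x, y) \<in> ?E" "y \<in> pverts G" if "y \<in> N" for y
    using that in_arcsD2 unfolding N_def by auto
  have edge: "i < 3" "j < 3" "i \<noteq> j"
    if "h \<in> S" "(u, v) \<in> ?E" "h u = Some i" "h v = Some j" for h u v i j
    using k_strategy_edge[OF S that] by (auto simp: complete_graph_def)
  obtain c where c: "[x \<mapsto> c] \<in> S"
    using k_strategy_singleton[OF S _ x] by auto
  have "\<exists>a. [x \<mapsto> c, r \<mapsto> a] \<in> S" if r: "r \<in> N" for r
  proof -
    obtain f where f: "f \<in> S" "[x \<mapsto> c] \<subseteq>\<^sub>m f" "dom f = {r, x}"
      using k_strategy_extend[OF S c, of r] N(2)[OF r] by auto
    then obtain a where a: "f r = Some a" by auto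
    have fx: "f x = Some c" using f(2) by (auto simp: map_le_def)
    have "f = [x \<mapsto> c, r \<mapsto> a]"
    proof
      fix u show "f u = [x \<mapsto> c, r \<mapsto> a] u"
        using f(3) a fx by (cases "u = r"; cases "u = x") auto
    qed
    then show ?thesis using f(1) by auto
  qed
  then obtain a where a: "\<And>r. r \<in> N \<Longrightarrow> [x \<mapsto> c, r \<mapsto> a r] \<in> S"
    by metis
  have rx: "r \<noteq> x" if "r \<in> N" for r
    using k_strategy_irrefl[OF G S] N(1)[OF that] by (auto simp: irrefl_def complete_graph_def)
  \<comment> \<open>\<open>d\<close> is a colour that the strategy allows at \<open>y\<close> while
    \<open>x\<close> and \<open>r\<close> keep their fixed colours. The case \<open>y = r\<close> is
    included.\<close>
  define A where "A r y d \<longleftrightarrow>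
    (\<exists>h \<in> S. dom h = {x, r, y} \<and> h x = Some c \<and> h r = Some (a r) \<and> h y = Some d)" for r y d
  \<comment> \<open>Transport along an edge: extend from \<open>x\<close>, \<open>r\<close>,
    \<open>y\<close> to \<open>z\<close>, then forget \<open>y\<close>. The intermediate map has up
    to four vertices, hence the 4 in the strategy.\<close>
  have forced: "\<exists>e. A r z e \<and> e \<noteq> d \<and> e \<noteq> c \<and> d \<noteq> c \<and> e < 3 \<and> d < 3 \<and> c < 3"
    if Ad: "A r y d" and R: "(y, z) \<in> R" for r y z d
  proof -
    have yz: "y \<in> N" "z \<in> N" "(y, z) \<in> ?E" using R by (auto simp: R_def)
    obtain h where h: "h \<in> S" "dom h = {x, r, y}" "h x = Some c" "h r = Some (a r)" "h y = Some d"
      using Ad unfolding A_def by blast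
    have "card (dom h) < 4"
      unfolding h(2) by (simp add: card_insert_if)
    then obtain f where f: "f \<in> S" "h \<subseteq>\<^sub>m f" "dom f = insert z (dom h)"
      using k_strategy_extend[OF S h(1) _ N(2)[OF yz(2)]] by blast
    then obtain e where e: "f z = Some e" by auto
    have fx: "f x = Some c" "f r = Some (a r)" "f y = Some d"
      using f(2) h(2-5) by (simp_all add: map_le_def)
    have "A r z e"
      unfolding A_def
    proof (intro bexI conjI)
      show "f |` {x, r, z} \<in> S" by (rule k_strategy_restrict[OF S f(1)])
      show "dom (f |` {x, r, z}) = {x, r, z}" using f(3) h(2) by auto
    qed (use fx e in auto)
    then show ?thesis
      using edge[OF f(1) yz(3) fx(3) e] edge[OF f(1) N(1)[OF yz(1)] fx(1,3)]
        edge[OF f(1) N(1)[OF yz(2)] fx(1) e] by auto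
  qed
  have symR: "(v, u) \<in> R" if "(u, v) \<in> R" for u v
    using that symE by (auto simp: R_def)
  \<comment> \<open>Existence is transported forwards along the path. For uniqueness a colour of
    \<open>z\<close> is transported back to \<open>y\<close>, where only \<open>d\<close> is
    possible; so it avoids both \<open>c\<close> and \<open>d\<close>, which leaves one of three
    colours.\<close>
  have unique: "\<exists>!d. A r y d" if "(r, y) \<in> R\<^sup>*" "r \<in> N" for r y
    using that(1)
  proof (induction rule: rtrancl_induct)
    case base
    have "A r r (a r)"
      unfolding A_def using a[OF that(2)] rx[OF that(2)]
      by (intro bexI[of _ "[x \<mapsto> c, r \<mapsto> a r]"]) auto
    moreover have "d = a r" if "A r r d" for d
      using that unfolding A_def by auto
    ultimately show ?case by blast
  next
    case (step y z)
    then obtain d where d: "A r y d" "\<And>d'. A r y d' \<Longrightarrow> d' = d" by blast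
    obtain e where e: "A r z e" "e \<noteq> d" "e \<noteq> c" "d \<noteq> c" "e < 3" "d < 3" "c < 3"
      using forced[OF d(1) step.hyps(2)] by blast
    have "e' = e" if Ae: "A r z e'" for e'
    proof -
      obtain d' where "A r y d'" "d' \<noteq> e'" "e' \<noteq> c" "e' < 3"
        using forced[OF Ae symR[OF step.hyps(2)]] by blast
      then show ?thesis using d(2)[of d'] e(2-7) by linarith
    qed
    then show ?case using e(1) by blast
  qed
  \<comment> \<open>Adjacent vertices satisfy the same predicate under \<open>SOME\<close>, so the
    whole component shares one root.\<close>
  define root where "root y = (SOME r. (r, y) \<in> R\<^sup>*)" for y
  have root: "(root y, y) \<in> R\<^sup>*" for y
    unfolding root_def by (rule someI[of _ y]) simp
  have root_N: "root y \<in> N" if "y \<in> N" for y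
    using root[of y] that by (cases rule: converse_rtranclE) (auto simp: R_def)
  have root_eq: "root y = root z" if "(y, z) \<in> R" for y z
  proof -
    have "(r, y) \<in> R\<^sup>* \<longleftrightarrow> (r, z) \<in> R\<^sup>*" for r
      using rtrancl_into_rtrancl[OF _ that, of r] rtrancl_into_rtrancl[OF _ symR[OF that], of r]
      by (rule iffI)
    then show ?thesis by (simp add: root_def)
  qed
  define col where "col y = (THE d. A (root y) y d)" for y
  have col: "A (root y) y d \<longleftrightarrow> d = col y" if "y \<in> N" for y d
  proof -
    note ex1 = unique[OF root root_N[OF that]]
    show ?thesis
      using theI'[OF ex1] the1_equality[OF ex1, of d] unfolding col_def by metis
  qed
  \<comment> \<open>Any colour other than \<open>c\<close> would do: adjacent neighbours of
    \<open>x\<close> carry the two colours different from \<open>c\<close>, so exactly one of them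
    has colour \<open>p\<close>.\<close>
  define p where "p = (if c = 0 then 1 else 0 :: nat)"
  have "proper_on ?E N (\<lambda>y. col y = p)"
    unfolding proper_on_def
  proof (intro ballI impI)
    fix y z assume yz: "y \<in> N" "z \<in> N" "(y, z) \<in> ?E"
    then have R: "(y, z) \<in> R" by (simp add: R_def)
    obtain e where e: "A (root y) z e" "e \<noteq> col y" "e \<noteq> c" "col y \<noteq> c"
      "e < 3" "col y < 3" "c < 3"
      using forced[OF _ R, of "root y" "col y"] col[OF yz(1)] by blast
    have "e = col z"
      using e(1) col[OF yz(2)] root_eq[OF R] by simp
    then show "(col y = p) \<noteq> (col z = p)"
      using e(2-7) unfolding p_def by (auto split: if_splits)
  qed
  then show ?thesis unfolding N_def by blast
qed

theorem theorem6p2: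
  fixes G :: "'a pair_pre_digraph" and n :: nat
  assumes "pair_pseudo_graph G"
    and "card (pverts G) = n"
    and "k_consistent 4 G (complete_graph 3)"
  shows "maps_to G (complete_graph (3 * nat \<lceil>sqrt (real n)\<rceil>))"
proof -
  interpret pair_pseudo_graph G by fact
  define s where "s = nat \<lceil>sqrt (real n)\<rceil>"
  obtain S where S: "k_strategy 4 G (complete_graph 3) S"
    using assms(3) unfolding k_consistent_def by blast
  have "sqrt (real n) \<le> real s"
    unfolding s_def by linarith
  then have "real n \<le> (real s)\<^sup>2"
    by (rule sqrt_le_D)
  then have ns: "n \<le> s * s"
    by (simp add: power2_eq_square flip: of_nat_mult)
  \<comment> \<open>Since \<open>n \<le> s * s\<close>, at most \<open>s\<close> rounds of two
    colours occur, followed by \<open>s\<close> greedy colours.\<close>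
  have "\<exists>f :: 'a \<Rightarrow> nat. f ` pverts G \<subseteq> {..<2 * s + s} \<and> proper_on (parcs G) (pverts G) f"
  proof (cases "s = 0")
    case True
    then have "pverts G = {}" using ns assms(2) by simp
    then show ?thesis by (simp add: proper_on_def)
  next
    case False
    show ?thesis
    proof (rule wigderson_colouring)
      show "sym (parcs G)" using sym_arcs by (simp add: symmetric_def)
      show "irrefl (parcs G)"
        using k_strategy_irrefl[OF assms(1) S] by (auto simp: complete_graph_def irrefl_def)
      show "\<exists>b :: 'a \<Rightarrow> bool. proper_on (parcs G) (parcs G `` {v}) b" if "v \<in> pverts G" for v
        by (rule neighbourhood_bipartite[OF assms(1) S that])
    qed (use False ns assms(2) in auto)
  qed
  then obtain f :: "'a \<Rightarrow> nat" where f: "f ` pverts G \<subseteq> {..<3 * s}" "proper_on (parcs G) (pverts G) f"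
    by auto
  have "graph_hom G (complete_graph (3 * s)) f"
    using f in_arcsD1 in_arcsD2 unfolding graph_hom_def complete_graph_def proper_on_def by fastforce
  then show ?thesis unfolding maps_to_def s_def by blast
qed

end
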